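(* Let $m\ge 0$ be a real constant. Consider the tensor-valued expressions $T^{\alpha\beta\gamma\delta}=T^{\alpha\beta\gamma\delta}[\phi]$, quadratic in a real scalar field $\phi$ on Minkowski spacetime, that satisfy properties P1 and P2 of the context. For a real scalar field $\phi$, let $\tau^{\alpha\beta}$ be the symmetric tensor $$\tau^{\alpha\beta}=\phi^{,\alpha\lambda}{\phi^{,\beta}}_{\lambda}-m^2\phi^{,\alpha}\phi^{,\beta}-\tfrac12 K g^{\alpha\beta},\qquad K=\tfrac12\phi^{,\rho\sigma}\phi_{,\rho\sigma}-m^2\phi^{,\lambda}\phi_{,\lambda}+\tfrac12 m^4\phi^2 .$$ Then the class of rank 4 tensors $T^{\alpha\beta\gamma\delta}$ fulfilling P1, P2 and also P3 (that is, ${T^{\alpha\beta\gamma\delta}}_{,\alpha}=0$ for every solution $\phi$ of $(\Box+m^2)\phi=0$) is exactly the two-parameter family $$T^{\alpha\beta\gamma\delta}=a\,T_1^{\alpha\beta\gamma\delta}+b\,T_2^{\alpha\beta\gamma\delta},\qquad a,b\in\mathbb{R},$$ where $$T_1^{\alpha\beta\gamma\delta}=\phi^{,\alpha\beta}\phi^{,\gamma\delta}+\tfrac12\left(g^{\alpha\beta}\tau^{\gamma\delta}+g^{\gamma\delta}\tau^{\alpha\beta}\right)-g^{\alpha(\gamma}\tau^{\delta)\beta}-g^{\beta(\gamma}\tau^{\delta)\alpha},$$ $$T_2^{\alpha\beta\gamma\delta}=\phi^{,\alpha(\gamma}\phi^{,\delta)\beta}-\tfrac12\left(g^{\alpha\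beta}\tau^{\gamma\delta}+g^{\gamma\delta}\tau^{\alpha\beta}\right).$$
   Context: Setting: Minkowski spacetime $\mathbb{R}^4$ with Galilean coordinates $x^\alpha$, $\alpha=0,1,2,3$, and metric $g_{\alpha\beta}=\mathrm{diag}(1,-1,-1,-1)$, used to raise and lower indices. Scalar fields $\phi$ are real and smooth; commas denote partial derivatives, e.g. $\phi_{,\alpha\beta}=\partial_\alpha\partial_\beta\phi$ and ${\phi^{,\beta}}_{\lambda}=g^{\beta\mu}\phi_{,\mu\lambda}$. $\Box=g^{\alpha\beta}\partial_\alpha\partial_\beta$. Round brackets denote symmetrization with weight one: $X^{(\alpha\beta)}=\frac12(X^{\alpha\beta}+X^{\beta\alpha})$; e.g. $\phi^{,\alpha(\gamma}\phi^{,\delta)\beta}=\frac12(\phi^{,\alpha\gamma}\phi^{,\delta\beta}+\phi^{,\alpha\delta}\phi^{,\gamma\beta})$ and $g^{\alpha(\gamma}\tau^{\delta)\beta}=\frac12(g^{\alpha\gamma}\tau^{\delta\beta}+g^{\alpha\delta}\tau^{\gamma\beta})$. P1: $T^{\alpha\beta\gamma\delta}$ is a sum of terms, each being a constant times a contraction, using metric components only, of $\phi\phi$, of $\phi^{,\mu}\phi^{,\nu}$, or of $\phi^{,\mu_1\mu_2}\phi^{,\nu_1\nu_2}$. P2: $T^{\alpha\beta\gamma\delta}=T^{\beta\alpha\gamma\delta}=T^{\alpha\beta\delta\gamma}$ and $T^{\alpha\beta\gamma\delta}=T^{\gamma\delta\alpha\beta}$. Precisely, the tensors satisfying P1 and P2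 are taken to be those of the form $$\begin{aligned}T^{\alpha\beta\gamma\delta}={}&a\,\phi^{,\alpha\beta}\phi^{,\gamma\delta}+b\,\phi^{,\gamma(\alpha}\phi^{,\beta)\delta}+\tfrac12c_1\left(g^{\alpha\beta}\phi^{,\gamma\lambda}{\phi^{,\delta}}_{\lambda}+g^{\gamma\delta}\phi^{,\alpha\lambda}{\phi^{,\beta}}_{\lambda}\right)\\&+c_2\left(g^{\gamma(\alpha}\phi^{,\beta)\lambda}{\phi^{,\delta}}_{\lambda}+g^{\delta(\alpha}\phi^{,\beta)\lambda}{\phi^{,\gamma}}_{\lambda}\right)+\tfrac12d_1m^2\left(g^{\alpha\beta}\phi^{,\gamma}\phi^{,\delta}+g^{\gamma\delta}\phi^{,\alpha}\phi^{,\beta}\right)\\&+d_2m^2\left(g^{\gamma(\alpha}\phi^{,\beta)}\phi^{,\delta}+g^{\delta(\alpha}\phi^{,\beta)}\phi^{,\gamma}\right)+\tfrac12K_1g^{\alpha\beta}g^{\gamma\delta}+K_2\,g^{\gamma(\alpha}g^{\beta)\delta},\end{aligned}$$ with $K_s=p_s\phi^{,\rho\sigma}\phi_{,\rho\sigma}+q_sm^2\phi^{,\lambda}\phi_{,\lambda}+r_sm^4\phi^2$ $(s=1,2)$ and real constants $a,b,c_s,d_s,p_s,q_s,r_s$. P3: ${T^{\alpha\beta\gamma\delta}}_{,\alpha}=0$ whenever $(\Box+m^2)\phi=0$. *)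

theory Defs
  imports "HOL-Analysis.Analysis"
begin

text \<open>
  The indices \<open>0, 1, 2, 3\<close> are the four elements of the numeral type \<open>4\<close>, in which
  \<open>4 = 0\<close>; the time coordinate is \<open>x $ 0\<close>.
\<close>

type_synonym spacetime = "real ^ 4"
type_synonym scalar_field = "spacetime \<Rightarrow> real"
type_synonym tensor2 = "4 \<Rightarrow> 4 \<Rightarrow> spacetime \<Rightarrow> real"
type_synonym tensor4 = "4 \<Rightarrow> 4 \<Rightarrow> 4 \<Rightarrow> 4 \<Rightarrow> spacetime \<Rightarrow> real"

definition pd :: "4 \<Rightarrow> scalar_field \<Rightarrow> scalar_field" where
  "pd \<alpha> f x = deriv (\<lambda>t. f (x + t *\<^sub>R axis \<alpha> 1)) 0"

text \<open>
  Differentiability of all iterated partial derivatives implies their continuity, so this is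
  \<open>C\<^sup>\<infinity>\<close> on the whole space.
\<close>

definition smooth :: "scalar_field \<Rightarrow> bool" where
  "smooth f \<longleftrightarrow> (\<forall>is x. foldr pd is f differentiable (at x))"

definition eta :: "4 \<Rightarrow> 4 \<Rightarrow> real" where
  "eta \<alpha> \<beta> = (if \<alpha> \<noteq> \<beta> then 0 else if \<alpha> = 0 then 1 else - 1)"

text \<open>The metric is its own inverse, so \<open>eta\<close> serves for both index positions.\<close>

lemma eta_inverse: "(\<Sum>\<mu>\<in>UNIV. eta \<alpha> \<mu> * eta \<mu> \<beta>) = (if \<alpha> = \<beta> then 1 else 0)"
proof -
  have "(\<Sum>\<mu>\<in>UNIV. eta \<alpha> \<mu> * eta \<mu> \<beta>) = (\<Sum>\<mu>\<in>UNIV. if \<mu> = \<alpha> then eta \<alpha> \<alpha> * eta \<alpha> \<beta> else 0)"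
    by (rule sum.cong) (auto simp: eta_def)
  then show ?thesis
    by (simp add: eta_def)
qed

definition symm :: "(4 \<Rightarrow> 4 \<Rightarrow> real) \<Rightarrow> 4 \<Rightarrow> 4 \<Rightarrow> real" where
  "symm X \<alpha> \<beta> = (X \<alpha> \<beta> + X \<beta> \<alpha>) / 2"

text \<open>
  Letters \<open>l\<close> and \<open>u\<close> record the index positions: \<open>dl\<close> is $\phi_{,\alpha}$, \<open>du\<close> is $\phi^{,\alpha}$,
  \<open>dll\<close> is $\phi_{,\alpha\beta}$, \<open>dul\<close> is ${\phi^{,\alpha}}_{\beta}$, \<open>duu\<close> is $\phi^{,\alpha\beta}$.
\<close>

definition dl :: "scalar_field \<Rightarrow> 4 \<Rightarrow> spacetime \<Rightarrow> real" where
  "dl \<phi> \<alpha> x = pd \<alpha> \<phi> x"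

definition du :: "scalar_field \<Rightarrow> 4 \<Rightarrow> spacetime \<Rightarrow> real" where
  "du \<phi> \<alpha> x = (\<Sum>\<mu>\<in>UNIV. eta \<alpha> \<mu> * dl \<phi> \<mu> x)"

definition dll :: "scalar_field \<Rightarrow> tensor2" where
  "dll \<phi> \<alpha> \<beta> x = pd \<alpha> (pd \<beta> \<phi>) x"

definition dul :: "scalar_field \<Rightarrow> tensor2" where
  "dul \<phi> \<alpha> \<beta> x = (\<Sum>\<mu>\<in>UNIV. eta \<alpha> \<mu> * dll \<phi> \<mu> \<beta> x)"

definition duu :: "scalar_field \<Rightarrow> tensor2" where
  "duu \<phi> \<alpha> \<beta> x = (\<Sum>\<mu>\<in>UNIV. \<Sum>\<nu>\<in>UNIV. eta \<alpha> \<mu> * eta \<beta> \<nu> * dll \<phi> \<mu> \<nu> x)"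

definition dalembert :: "scalar_field \<Rightarrow> scalar_field" where
  "dalembert \<phi> x = (\<Sum>\<alpha>\<in>UNIV. \<Sum>\<beta>\<in>UNIV. eta \<alpha> \<beta> * dll \<phi> \<alpha> \<beta> x)"

definition klein_gordon :: "real \<Rightarrow> scalar_field \<Rightarrow> bool" where
  "klein_gordon m \<phi> \<longleftrightarrow> smooth \<phi> \<and> (\<forall>x. dalembert \<phi> x + m\<^sup>2 * \<phi> x = 0)"

text \<open>\<open>dd\<close> is $\phi^{,\alpha\lambda}{\phi^{,\beta}}_{\lambda}$.\<close>

definition dd :: "scalar_field \<Rightarrow> tensor2" where
  "dd \<phi> \<alpha> \<beta> x = (\<Sum>l\<in>UNIV. duu \<phi> \<alpha> l x * dul \<phi> \<beta> l x)"

definition K_scalar :: "real \<Rightarrow> real \<Rightarrow> real \<Rightarrow> real \<Rightarrow> scalar_field \<Rightarrow> spacetime \<Rightarrow> real" where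
  "K_scalar m p q r \<phi> x =
     p * (\<Sum>\<rho>\<in>UNIV. \<Sum>\<sigma>\<in>UNIV. duu \<phi> \<rho> \<sigma> x * dll \<phi> \<rho> \<sigma> x)
     + q * m\<^sup>2 * (\<Sum>l\<in>UNIV. du \<phi> l x * dl \<phi> l x)
     + r * m ^ 4 * (\<phi> x)\<^sup>2"

definition general_tensor ::
  "real \<Rightarrow> real \<Rightarrow> real \<Rightarrow> real \<Rightarrow> real \<Rightarrow> real \<Rightarrow> real \<Rightarrow>
   real \<Rightarrow> real \<Rightarrow> real \<Rightarrow> real \<Rightarrow> real \<Rightarrow> real \<Rightarrow> scalar_field \<Rightarrow> tensor4" where
  "general_tensor m a b c1 c2 d1 d2 p1 q1 r1 p2 q2 r2 \<phi> \<alpha> \<beta> \<gamma> \<delta> x =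
     a * duu \<phi> \<alpha> \<beta> x * duu \<phi> \<gamma> \<delta> x
     + b * symm (\<lambda>\<alpha> \<beta>. duu \<phi> \<gamma> \<alpha> x * duu \<phi> \<beta> \<delta> x) \<alpha> \<beta>
     + 1 / 2 * c1 * (eta \<alpha> \<beta> * dd \<phi> \<gamma> \<delta> x + eta \<gamma> \<delta> * dd \<phi> \<alpha> \<beta> x)
     + c2 * (symm (\<lambda>\<alpha> \<beta>. eta \<gamma> \<alpha> * dd \<phi> \<beta> \<delta> x) \<alpha> \<beta>
             + symm (\<lambda>\<alpha> \<beta>. eta \<delta> \<alpha> * dd \<phi> \<beta> \<gamma> x) \<alpha> \<beta>)
     + 1 / 2 * d1 * m\<^sup>2 * (eta \<alpha> \<beta> * du \<phi> \<gamma> x * du \<phi> \<delta> x + eta \<gamma> \<delta> * du \<phi> \<alpha> x * du \<phi> \<beta> x)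
     + d2 * m\<^sup>2 * (symm (\<lambda>\<alpha> \<beta>. eta \<gamma> \<alpha> * du \<phi> \<beta> x) \<alpha> \<beta> * du \<phi> \<delta> x
                    + symm (\<lambda>\<alpha> \<beta>. eta \<delta> \<alpha> * du \<phi> \<beta> x) \<alpha> \<beta> * du \<phi> \<gamma> x)
     + 1 / 2 * K_scalar m p1 q1 r1 \<phi> x * eta \<alpha> \<beta> * eta \<gamma> \<delta>
     + K_scalar m p2 q2 r2 \<phi> x * symm (\<lambda>\<alpha> \<beta>. eta \<gamma> \<alpha> * eta \<beta> \<delta>) \<alpha> \<beta>"

text \<open>
  Tensor-valued expressions are identified when they agree on all smooth fields, whether or not
  these solve the field equation; values at non-smooth functions are irrelevant.
\<close>

definition P1_P2 :: "real \<Rightarrow> (scalar_field \<Rightarrow> tensor4) \<Rightarrow> bool" where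
  "P1_P2 m T \<longleftrightarrow> (\<exists>a b c1 c2 d1 d2 p1 q1 r1 p2 q2 r2. \<forall>\<phi>. smooth \<phi> \<longrightarrow>
     T \<phi> = general_tensor m a b c1 c2 d1 d2 p1 q1 r1 p2 q2 r2 \<phi>)"

definition P3 :: "real \<Rightarrow> (scalar_field \<Rightarrow> tensor4) \<Rightarrow> bool" where
  "P3 m T \<longleftrightarrow> (\<forall>\<phi>. klein_gordon m \<phi> \<longrightarrow>
     (\<forall>\<beta> \<gamma> \<delta> x. (\<Sum>\<alpha>\<in>UNIV. pd \<alpha> (T \<phi> \<alpha> \<beta> \<gamma> \<delta>) x) = 0))"

definition tau :: "real \<Rightarrow> scalar_field \<Rightarrow> tensor2" where
  "tau m \<phi> \<alpha> \<beta> x = dd \<phi> \<alpha> \<beta> x - m\<^sup>2 * du \<phi> \<alpha> x * du \<phi> \<beta> x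
     - 1 / 2 * K_scalar m (1 / 2) (- 1) (1 / 2) \<phi> x * eta \<alpha> \<beta>"

definition T1 :: "real \<Rightarrow> scalar_field \<Rightarrow> tensor4" where
  "T1 m \<phi> \<alpha> \<beta> \<gamma> \<delta> x =
     duu \<phi> \<alpha> \<beta> x * duu \<phi> \<gamma> \<delta> x
     + 1 / 2 * (eta \<alpha> \<beta> * tau m \<phi> \<gamma> \<delta> x + eta \<gamma> \<delta> * tau m \<phi> \<alpha> \<beta> x)
     - symm (\<lambda>\<gamma> \<delta>. eta \<alpha> \<gamma> * tau m \<phi> \<delta> \<beta> x) \<gamma> \<delta>
     - symm (\<lambda>\<gamma> \<delta>. eta \<beta> \<gamma> * tau m \<phi> \<delta> \<alpha> x) \<gamma> \<delta>"

definition T2 :: "real \<Rightarrow> scalar_field \<Rightarrow> tensor4" where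
  "T2 m \<phi> \<alpha> \<beta> \<gamma> \<delta> x =
     symm (\<lambda>\<gamma> \<delta>. duu \<phi> \<alpha> \<gamma> x * duu \<phi> \<delta> \<beta> x) \<gamma> \<delta>
     - 1 / 2 * (eta \<alpha> \<beta> * tau m \<phi> \<gamma> \<delta> x + eta \<gamma> \<delta> * tau m \<phi> \<alpha> \<beta> x)"

end

theory Submission
  imports Defs
begin

text \<open>
  On solutions the divergence of the general ansatz is a linear combination of ten cubic-jet
  expressions (\<open>jet_form\<close>), whose coefficients are linear in the constants of the ansatz; the
  two-parameter family is where all ten vanish (for \<open>m = 0\<close> only four of them count). That they must vanish is seen on the solutions
  \<open>exp (k \<bullet> x) \<plusminus> exp (l \<bullet> x)\<close> with real \<open>k\<close>, \<open>l\<close> of Minkowski square \<open>- m\<^sup>2\<close>. The cross terms are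
  polynomials in the Minkowski product \<open>t\<close> of \<open>k\<close> and \<open>l\<close>, and \<open>t\<close> can be any nonzero real.
\<close>

section \<open>Raised partial derivatives\<close>

text \<open>The metric is diagonal, so raising an index only multiplies by a sign. Applying
  \<open>up\<close> once per index makes every jet component fully contravariant, and the metric
  then enters only through explicit \<open>eta\<close> factors and contractions.\<close>

definition up :: "4 \<Rightarrow> scalar_field \<Rightarrow> scalar_field" where
  "up \<alpha> f x = eta \<alpha> \<alpha> * pd \<alpha> f x"

text \<open>A relational form of the raised derivative: it asserts existence together with the
  value, which an equation for \<open>pd\<close> (defined through \<open>deriv\<close>) does not.
  The sign is absorbed into the direction of the line, so the one-variable derivative rules carry
  over verbatim.\<close>

definition has_up :: "4 \<Rightarrow> scalar_field \<Rightarrow> real \<Rightarrow> spacetime \<Rightarrow> bool" where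
  "has_up \<alpha> f d x \<longleftrightarrow> ((\<lambda>t. f (x + (t * eta \<alpha> \<alpha>) *\<^sub>R axis \<alpha> 1)) has_real_derivative d) (at 0)"

lemma eta_diag_square [simp]: "eta \<alpha> \<alpha> * eta \<alpha> \<alpha> = 1" "eta \<alpha> \<alpha> * (eta \<alpha> \<alpha> * c) = c"
  by (auto simp: eta_def)

lemma eta_commute: "eta \<alpha> \<beta> = eta \<beta> \<alpha>"
  by (simp add: eta_def)

lemma sum_eta_left: "(\<Sum>\<mu>\<in>UNIV. eta \<alpha> \<mu> * X \<mu>) = eta \<alpha> \<alpha> * X \<alpha>"
proof -
  have "(\<Sum>\<mu>\<in>UNIV. eta \<alpha> \<mu> * X \<mu>) = (\<Sum>\<mu>\<in>UNIV. if \<mu> = \<alpha> then eta \<alpha> \<alpha> * X \<alpha> else 0)"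
    by (rule sum.cong) (auto simp: eta_def)
  then show ?thesis by simp
qed

section \<open>Partial derivatives along coordinate lines and equality of mixed partials\<close>

lemma pd_along_line:
  assumes "f differentiable (at (x + s *\<^sub>R axis \<alpha> 1))"
  shows "((\<lambda>t. f (x + t *\<^sub>R axis \<alpha> 1)) has_real_derivative pd \<alpha> f (x + s *\<^sub>R axis \<alpha> 1)) (at s)"
proof -
  let ?v = "axis \<alpha> 1 :: spacetime"
  obtain D where D: "(f has_derivative D) (at (x + s *\<^sub>R ?v))"
    using assms unfolding differentiable_def by blast
  have lin: "D (t *\<^sub>R ?v) = t * D ?v" for t
    using D by (simp add: has_derivative_def bounded_linear.linear linear_cmul)
  \<comment> \<open>Base point and parameter are both free as long as they reach the same point. One
    use has parameter 0 and evaluates \<open>pd\<close> there; the other has base point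
    \<open>x\<close> and parameter \<open>s\<close>, the form that the mean value theorem
    takes.\<close>
  have at: "((\<lambda>t. f (y + t *\<^sub>R ?v)) has_real_derivative D ?v) (at r)"
    if y: "y + r *\<^sub>R ?v = x + s *\<^sub>R ?v" for y r
  proof -
    have "((\<lambda>t. f (y + t *\<^sub>R ?v)) has_derivative (\<lambda>t. D (t *\<^sub>R ?v))) (at r)"
      by (rule has_derivative_compose[where g = f and f = "\<lambda>t. y + t *\<^sub>R ?v", unfolded o_def])
         (use D y in \<open>auto intro!: derivative_eq_intros\<close>)
    then show ?thesis
      unfolding has_field_derivative_def by (simp add: lin mult_commute_abs)
  qed
  have "pd \<alpha> f (x + s *\<^sub>R ?v) = D ?v"
    unfolding pd_def by (rule DERIV_imp_deriv, rule at) simp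
  then show ?thesis using at[of x s] by simp
qed

lemma pd_eqI:
  "((\<lambda>t. f (x + t *\<^sub>R axis \<alpha> 1)) has_real_derivative d) (at 0) \<Longrightarrow> pd \<alpha> f x = d"
  unfolding pd_def by (rule DERIV_imp_deriv)

text \<open>The second difference over a square of side \<open>h\<close> is an increment of
  \<open>s \<mapsto> f (x + h b + s a) - f (x + s a)\<close>, with \<open>a\<close>,
  \<open>b\<close> the two axis vectors. The mean value theorem applies first to this function and
  then, in the other direction, to \<open>pd \<alpha> f\<close>.\<close>

lemma mean_value_mixed:
  assumes f: "\<And>x. f differentiable (at x)" and fa: "\<And>x. pd \<alpha> f differentiable (at x)" and h: "h > 0"
  shows "\<exists>s u. 0 < s \<and> s < h \<and> 0 < u \<and> u < h \<and>
    f (x + h *\<^sub>R axis \<alpha> 1 + h *\<^sub>R axis \<beta> 1) - f (x + h *\<^sub>R axis \<alpha> 1) - f (x + h *\<^sub>R axis \<beta> 1) + f x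
      = h * (h * pd \<beta> (pd \<alpha> f) (x + s *\<^sub>R axis \<alpha> 1 + u *\<^sub>R axis \<beta> 1))"
proof -
  let ?a = "axis \<alpha> 1 :: spacetime" and ?b = "axis \<beta> 1 :: spacetime"
  define g where "g = (\<lambda>s. f ((x + h *\<^sub>R ?b) + s *\<^sub>R ?a) - f (x + s *\<^sub>R ?a))"
  have dg: "(g has_real_derivative (pd \<alpha> f ((x + h *\<^sub>R ?b) + s *\<^sub>R ?a) - pd \<alpha> f (x + s *\<^sub>R ?a))) (at s)" for s
    unfolding g_def by (intro DERIV_diff pd_along_line f)
  obtain s where s: "0 < s" "s < h"
    "g h - g 0 = (h - 0) * (pd \<alpha> f ((x + h *\<^sub>R ?b) + s *\<^sub>R ?a) - pd \<alpha> f (x + s *\<^sub>R ?a))"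
    using MVT2[OF h dg] by blast
  obtain u where u: "0 < u" "u < h"
    "pd \<alpha> f ((x + s *\<^sub>R ?a) + h *\<^sub>R ?b) - pd \<alpha> f ((x + s *\<^sub>R ?a) + 0 *\<^sub>R ?b)
      = (h - 0) * pd \<beta> (pd \<alpha> f) ((x + s *\<^sub>R ?a) + u *\<^sub>R ?b)"
    using MVT2[OF h pd_along_line[of "pd \<alpha> f" "x + s *\<^sub>R ?a", OF fa]] by blast
  have "g h - g 0 = f (x + h *\<^sub>R ?a + h *\<^sub>R ?b) - f (x + h *\<^sub>R ?a) - f (x + h *\<^sub>R ?b) + f x"
    by (simp add: g_def add_ac)
  with s u show ?thesis
    by (intro exI[of _ s] exI[of _ u]) (simp add: add_ac)
qed

text \<open>Both orders of differentiation represent the same second difference, each by a mixed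
  partial at some point close to \<open>x\<close>. Continuity at \<open>x\<close> then forces the
  two values together.\<close>

lemma pd_commute:
  assumes f: "\<And>x. f differentiable (at x)"
    and fa: "\<And>x. pd \<alpha> f differentiable (at x)" and fb: "\<And>x. pd \<beta> f differentiable (at x)"
    and cab: "isCont (pd \<alpha> (pd \<beta> f)) x" and cba: "isCont (pd \<beta> (pd \<alpha> f)) x"
  shows "pd \<alpha> (pd \<beta> f) x = pd \<beta> (pd \<alpha> f) x"
proof (rule ccontr)
  let ?a = "axis \<alpha> 1 :: spacetime" and ?b = "axis \<beta> 1 :: spacetime"
  let ?F = "pd \<alpha> (pd \<beta> f)" and ?G = "pd \<beta> (pd \<alpha> f)"
  assume ne: "?F x \<noteq> ?G x"
  \<comment> \<open>Half the gap: no number lies within less than \<open>r\<close> of both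
    values.\<close>
  define r where "r = \<bar>?F x - ?G x\<bar> / 2"
  have r: "r > 0" using ne by (simp add: r_def)
  obtain d1 where d1: "d1 > 0" "\<And>y. dist y x < d1 \<Longrightarrow> dist (?F y) (?F x) < r"
    using cab r unfolding continuous_at_eps_delta by meson
  obtain d2 where d2: "d2 > 0" "\<And>y. dist y x < d2 \<Longrightarrow> dist (?G y) (?G x) < r"
    using cba r unfolding continuous_at_eps_delta by meson
  \<comment> \<open>The points supplied by the mean value theorem lie within \<open>2 * h\<close> of
    \<open>x\<close>, hence inside both continuity radii.\<close>
  define h where "h = min d1 d2 / 2"
  have h: "h > 0" "2 * h \<le> d1" "2 * h \<le> d2" using d1(1) d2(1) by (auto simp: h_def)
  have close: "dist (x + s *\<^sub>R v + u *\<^sub>R w) x < 2 * h"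
    if "0 < s" "s < h" "0 < u" "u < h" "norm v = 1" "norm w = 1" for s u and v w :: spacetime
  proof -
    have "dist (x + s *\<^sub>R v + u *\<^sub>R w) x = norm (s *\<^sub>R v + u *\<^sub>R w)"
      by (simp add: dist_norm add.assoc)
    also have "\<dots> \<le> norm (s *\<^sub>R v) + norm (u *\<^sub>R w)" by (rule norm_triangle_ineq)
    also have "\<dots> < 2 * h" using that by simp
    finally show ?thesis .
  qed
  obtain s u where su: "0 < s" "s < h" "0 < u" "u < h"
    "f (x + h *\<^sub>R ?a + h *\<^sub>R ?b) - f (x + h *\<^sub>R ?a) - f (x + h *\<^sub>R ?b) + f x
      = h * (h * ?G (x + s *\<^sub>R ?a + u *\<^sub>R ?b))"
    using mean_value_mixed[OF f fa h(1)] by blast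
  obtain s' u' where su': "0 < s'" "s' < h" "0 < u'" "u' < h"
    "f (x + h *\<^sub>R ?b + h *\<^sub>R ?a) - f (x + h *\<^sub>R ?b) - f (x + h *\<^sub>R ?a) + f x
      = h * (h * ?F (x + s' *\<^sub>R ?b + u' *\<^sub>R ?a))"
    using mean_value_mixed[OF f fb h(1)] by blast
  \<comment> \<open>The two second differences use the same four corners of the square.\<close>
  have "x + h *\<^sub>R ?b + h *\<^sub>R ?a = x + h *\<^sub>R ?a + h *\<^sub>R ?b" by (simp add: add_ac)
  then have "h * (h * ?G (x + s *\<^sub>R ?a + u *\<^sub>R ?b)) = h * (h * ?F (x + s' *\<^sub>R ?b + u' *\<^sub>R ?a))"
    using su(5) su'(5) by (smt (verit))
  then have eq: "?G (x + s *\<^sub>R ?a + u *\<^sub>R ?b) = ?F (x + s' *\<^sub>R ?b + u' *\<^sub>R ?a)"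
    using h(1) by simp
  have "dist (?F (x + s' *\<^sub>R ?b + u' *\<^sub>R ?a)) (?F x) < r"
    using close[OF su'(1-4), of ?b ?a] h by (intro d1(2)) simp
  moreover have "dist (?G (x + s *\<^sub>R ?a + u *\<^sub>R ?b)) (?G x) < r"
    using close[OF su(1-4), of ?a ?b] h by (intro d2(2)) simp
  ultimately show False
    using eq unfolding r_def dist_real_def by (smt (verit) field_sum_of_halves)
qed

section \<open>Smooth fields and their raised derivatives\<close>

lemma smooth_differentiable: "smooth f \<Longrightarrow> f differentiable (at x)"
  unfolding smooth_def by (erule allE[of _ "[]"]) simp

lemma smooth_pd: "smooth f \<Longrightarrow> smooth (pd \<alpha> f)"
  unfolding smooth_def
proof (intro allI)
  fix "is" x
  assume "\<forall>is x. foldr pd is f differentiable (at x)"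
  \<comment> \<open>In \<open>foldr\<close> the last list entry acts first, so a derivative taken
    beforehand is appended at the end.\<close>
  then have "foldr pd (is @ [\<alpha>]) f differentiable (at x)" by blast
  then show "foldr pd is (pd \<alpha> f) differentiable (at x)" by simp
qed

lemma smooth_cmult:
  assumes f: "smooth f"
  shows "smooth (\<lambda>x. c * f x)"
proof -
  have "foldr pd is (\<lambda>x. c * f x) = (\<lambda>x. c * foldr pd is f x)" for "is"
  proof (induction "is")
    case (Cons \<alpha> "is")
    have "pd \<alpha> (\<lambda>x. c * foldr pd is f x) x = c * pd \<alpha> (foldr pd is f) x" for x
      by (intro pd_eqI DERIV_cmult) (use f pd_along_line[of "foldr pd is f" x 0 \<alpha>] in \<open>simp add: smooth_def\<close>)
    then show ?case using Cons by auto
  qed simp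
  then show ?thesis
    using f unfolding smooth_def by (auto intro!: differentiable_mult)
qed

lemma smooth_up: "smooth f \<Longrightarrow> smooth (up \<alpha> f)"
  using smooth_cmult[OF smooth_pd, of f "eta \<alpha> \<alpha>" \<alpha>] by (simp add: up_def[abs_def])

lemma has_up_up:
  assumes "smooth f"
  shows "has_up \<alpha> f (up \<alpha> f x) x"
proof -
  have "((\<lambda>t. t * eta \<alpha> \<alpha>) has_real_derivative eta \<alpha> \<alpha>) (at 0)"
    by (auto intro!: derivative_eq_intros)
  moreover have "((\<lambda>t. f (x + t *\<^sub>R axis \<alpha> 1)) has_real_derivative pd \<alpha> f x) (at (0 * eta \<alpha> \<alpha>))"
    using pd_along_line[OF smooth_differentiable[OF assms], where s = 0] by simp
  ultimately show ?thesis
    unfolding has_up_def up_def by (subst mult.commute) (rule DERIV_chain2)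
qed

lemma pd_eq_if_has_up:
  assumes "has_up \<alpha> f d x"
  shows "pd \<alpha> f x = eta \<alpha> \<alpha> * d"
proof (rule pd_eqI)
  have "((\<lambda>t. t * eta \<alpha> \<alpha>) has_real_derivative eta \<alpha> \<alpha>) (at 0)"
    by (auto intro!: derivative_eq_intros)
  moreover have "((\<lambda>t. f (x + (t * eta \<alpha> \<alpha>) *\<^sub>R axis \<alpha> 1)) has_real_derivative d) (at (0 * eta \<alpha> \<alpha>))"
    using assms by (simp add: has_up_def)
  \<comment> \<open>Rescaling the parameter by the same sign a second time restores the unit-speed
    line, because the sign squares to 1.\<close>
  ultimately have "((\<lambda>t. f (x + (t * eta \<alpha> \<alpha> * eta \<alpha> \<alpha>) *\<^sub>R axis \<alpha> 1)) has_real_derivative d * eta \<alpha> \<alpha>) (at 0)"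
    by (rule DERIV_chain2[rotated])
  then show "((\<lambda>t. f (x + t *\<^sub>R axis \<alpha> 1)) has_real_derivative eta \<alpha> \<alpha> * d) (at 0)"
    by (simp add: mult.assoc mult.commute[of d])
qed

lemma up_commute:
  assumes f: "smooth f"
  shows "up \<alpha> (up \<beta> f) x = up \<beta> (up \<alpha> f) x"
proof -
  have pull: "pd \<alpha> (\<lambda>x. c * g x) x = c * pd \<alpha> g x" if "smooth g" for c \<alpha> x and g :: scalar_field
    by (intro pd_eqI DERIV_cmult)
       (use that pd_along_line[of g x 0 \<alpha>] smooth_differentiable in simp)
  have cont: "isCont g x" if "smooth g" for g :: scalar_field
    using smooth_differentiable[OF that] by (simp add: differentiable_imp_continuous_within)
  have "pd \<alpha> (pd \<beta> f) x = pd \<beta> (pd \<alpha> f) x"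
    by (intro pd_commute smooth_differentiable cont smooth_pd f)
  then show ?thesis
    by (simp add: up_def[abs_def] pull smooth_pd f)
qed

section \<open>The tensors of the statement in terms of raised derivatives\<close>

lemma du_eq: "du \<phi> \<alpha> = up \<alpha> \<phi>"
  by (rule ext) (simp add: du_def dl_def up_def sum_eta_left)

lemma up_dl: "up \<alpha> \<phi> x = eta \<alpha> \<alpha> * dl \<phi> \<alpha> x"
  by (simp add: dl_def up_def)

lemma up_up_dll:
  assumes "smooth \<phi>"
  shows "up \<alpha> (up \<beta> \<phi>) x = eta \<alpha> \<alpha> * (eta \<beta> \<beta> * dll \<phi> \<alpha> \<beta> x)"
proof -
  have "pd \<alpha> (up \<beta> \<phi>) x = eta \<beta> \<beta> * pd \<alpha> (pd \<beta> \<phi>) x"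
    unfolding up_def[abs_def]
    by (intro pd_eqI DERIV_cmult)
       (use pd_along_line[of "pd \<beta> \<phi>" x 0 \<alpha>] smooth_differentiable[OF smooth_pd[OF assms]] in simp)
  then show ?thesis by (simp add: up_def dll_def)
qed

lemma duu_eq: "smooth \<phi> \<Longrightarrow> duu \<phi> \<alpha> \<beta> = up \<alpha> (up \<beta> \<phi>)"
proof (rule ext)
  fix x assume "smooth \<phi>"
  then show "duu \<phi> \<alpha> \<beta> x = up \<alpha> (up \<beta> \<phi>) x"
    by (simp add: duu_def up_up_dll sum_distrib_left[symmetric] mult.assoc sum_eta_left)
qed

lemma dd_eq:
  "smooth \<phi> \<Longrightarrow> dd \<phi> \<alpha> \<beta> x = (\<Sum>l\<in>UNIV. eta l l * (up \<alpha> (up l \<phi>) x * up \<beta> (up l \<phi>) x))"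
  unfolding dd_def
  by (rule sum.cong) (auto simp: duu_eq dul_def sum_eta_left up_up_dll mult_ac)

lemma K_scalar_eq:
  "smooth \<phi> \<Longrightarrow> K_scalar m p q r \<phi> x =
    p * (\<Sum>\<rho>\<in>UNIV. eta \<rho> \<rho> * (\<Sum>\<sigma>\<in>UNIV. eta \<sigma> \<sigma> * (up \<rho> (up \<sigma> \<phi>) x)\<^sup>2))
    + q * m\<^sup>2 * (\<Sum>l\<in>UNIV. eta l l * (up l \<phi> x)\<^sup>2) + r * m ^ 4 * (\<phi> x)\<^sup>2"
  unfolding K_scalar_def
  by (simp add: duu_eq du_eq up_up_dll up_dl[of _ \<phi>] sum_distrib_left power2_eq_square mult_ac)

lemma klein_gordon_up:
  assumes "klein_gordon m \<phi>"
  shows "(\<Sum>\<alpha>\<in>UNIV. eta \<alpha> \<alpha> * up \<alpha> (up \<alpha> \<phi>) x) = - m\<^sup>2 * \<phi> x"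
proof -
  have s: "smooth \<phi>" and d: "dalembert \<phi> x + m\<^sup>2 * \<phi> x = 0"
    using assms by (auto simp: klein_gordon_def)
  then have "dalembert \<phi> x = - m\<^sup>2 * \<phi> x" by linarith
  then show ?thesis
    by (simp add: dalembert_def sum_eta_left up_up_dll s)
qed

section \<open>Divergence of the ansatz\<close>

lemma has_up_add: "has_up \<alpha> f d x \<Longrightarrow> has_up \<alpha> g d' x \<Longrightarrow> has_up \<alpha> (\<lambda>x. f x + g x) (d + d') x"
  unfolding has_up_def by (rule DERIV_add)

lemma has_up_mult:
  "has_up \<alpha> f d x \<Longrightarrow> has_up \<alpha> g d' x \<Longrightarrow> has_up \<alpha> (\<lambda>x. f x * g x) (d * g x + f x * d') x"
  unfolding has_up_def by (auto intro!: derivative_eq_intros)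

lemma has_up_cmult: "has_up \<alpha> f d x \<Longrightarrow> has_up \<alpha> (\<lambda>x. c * f x) (c * d) x"
  unfolding has_up_def by (rule DERIV_cmult)

lemma has_up_sum:
  "(\<And>i. has_up \<alpha> (f i) (d i) x) \<Longrightarrow> has_up \<alpha> (\<lambda>x. \<Sum>i\<in>I. f i x) (\<Sum>i\<in>I. d i) x"
  unfolding has_up_def by (rule DERIV_sum)

lemma has_up_unique: "has_up \<alpha> f d x \<Longrightarrow> has_up \<alpha> f d' x \<Longrightarrow> d = d'"
  unfolding has_up_def by (rule DERIV_unique)

lemma has_up_cong_value: "has_up \<alpha> f d x \<Longrightarrow> d = d' \<Longrightarrow> has_up \<alpha> f d' x"
  by simp

lemmas has_up_jet = has_up_up has_up_up[OF smooth_up] has_up_up[OF smooth_up[OF smooth_up]]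

text \<open>Contraction of two upper indices, a single signed sum since the metric is diagonal.
  Treating it as a linear functional lets the divergence be computed by rewriting, without expanding
  into components.\<close>

definition contr :: "(4 \<Rightarrow> real) \<Rightarrow> real" where
  "contr X = (\<Sum>\<alpha>\<in>UNIV. eta \<alpha> \<alpha> * X \<alpha>)"

lemma contr_add: "contr (\<lambda>\<alpha>. X \<alpha> + Y \<alpha>) = contr X + contr Y"
  by (simp add: contr_def distrib_left sum.distrib)

lemma contr_cmult: "contr (\<lambda>\<alpha>. c * X \<alpha>) = c * contr X"
  unfolding contr_def sum_distrib_left by (rule sum.cong) simp_all

lemma contr_multc: "contr (\<lambda>\<alpha>. X \<alpha> * c) = contr X * c"
  unfolding contr_def sum_distrib_right by (rule sum.cong) simp_all

lemma contr_eta: "contr (\<lambda>\<alpha>. eta \<alpha> \<beta> * X \<alpha>) = X \<beta>" "contr (\<lambda>\<alpha>. eta \<beta> \<alpha> * X \<alpha>) = X \<beta>"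
proof -
  have "contr (\<lambda>\<alpha>. eta \<beta> \<alpha> * X \<alpha>) = (\<Sum>\<alpha>\<in>UNIV. eta \<beta> \<alpha> * (eta \<alpha> \<alpha> * X \<alpha>))"
    by (simp add: contr_def mult_ac)
  then show "contr (\<lambda>\<alpha>. eta \<beta> \<alpha> * X \<alpha>) = X \<beta>"
    by (simp add: sum_eta_left)
  then show "contr (\<lambda>\<alpha>. eta \<alpha> \<beta> * X \<alpha>) = X \<beta>"
    by (simp add: eta_commute)
qed

lemma contr_swap: "contr (\<lambda>\<alpha>. contr (\<lambda>\<beta>. X \<alpha> \<beta>)) = contr (\<lambda>\<beta>. contr (\<lambda>\<alpha>. X \<alpha> \<beta>))"
  unfolding contr_def sum_distrib_left by (subst sum.swap) (simp add: mult_ac)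

lemma has_up_contr:
  "(\<And>i. has_up \<alpha> (f i) (d i) x) \<Longrightarrow> has_up \<alpha> (\<lambda>x. contr (\<lambda>i. f i x)) (contr d) x"
  unfolding contr_def by (intro has_up_sum has_up_cmult)

lemma has_up_square: "has_up \<alpha> f d x \<Longrightarrow> has_up \<alpha> (\<lambda>x. (f x)\<^sup>2) (2 * (f x * d)) x"
  using has_up_mult[of \<alpha> f d x f d] by (simp add: power2_eq_square mult_ac)

text \<open>This arises when the divergence index sits on one second-derivative factor while the
  other factor is differentiated.\<close>

definition A_jet :: "scalar_field \<Rightarrow> spacetime \<Rightarrow> 4 \<Rightarrow> 4 \<Rightarrow> 4 \<Rightarrow> real" where
  "A_jet \<phi> x \<beta> \<gamma> \<delta> = contr (\<lambda>\<alpha>. up \<alpha> (up \<beta> \<phi>) x * up \<alpha> (up \<gamma> (up \<delta> \<phi>)) x)"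

text \<open>For smooth fields, half the raised gradient of the full square of the second
  derivatives, the first term of \<open>K_scalar\<close>.\<close>

definition B_jet :: "scalar_field \<Rightarrow> spacetime \<Rightarrow> 4 \<Rightarrow> real" where
  "B_jet \<phi> x \<beta> = contr (\<lambda>\<alpha>. contr (\<lambda>\<gamma>. up \<alpha> (up \<gamma> \<phi>) x * up \<beta> (up \<alpha> (up \<gamma> \<phi>)) x))"

text \<open>For smooth fields, half the raised gradient of the Minkowski square of the first
  derivatives.\<close>

definition C_jet :: "scalar_field \<Rightarrow> spacetime \<Rightarrow> 4 \<Rightarrow> real" where
  "C_jet \<phi> x \<beta> = contr (\<lambda>\<alpha>. up \<alpha> \<phi> x * up \<alpha> (up \<beta> \<phi>) x)"

lemma up_up_eq: "smooth f \<Longrightarrow> up \<alpha> (up \<beta> f) = up \<beta> (up \<alpha> f)"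
  by (rule ext) (rule up_commute)

lemma A_jet_commute: "smooth \<phi> \<Longrightarrow> A_jet \<phi> x \<beta> \<gamma> \<delta> = A_jet \<phi> x \<beta> \<delta> \<gamma>"
  using up_up_eq[of \<phi> \<gamma> \<delta>] by (simp add: A_jet_def)

lemma has_up_dd:
  assumes "smooth \<phi>"
  shows "has_up \<alpha> (dd \<phi> \<beta> \<gamma>) (contr (\<lambda>l. up \<alpha> (up \<beta> (up l \<phi>)) x * up \<gamma> (up l \<phi>) x
    + up \<beta> (up l \<phi>) x * up \<alpha> (up \<gamma> (up l \<phi>)) x)) x"
proof -
  have "dd \<phi> \<beta> \<gamma> = (\<lambda>x. contr (\<lambda>l. up \<beta> (up l \<phi>) x * up \<gamma> (up l \<phi>) x))"
    using assms by (auto simp: dd_eq contr_def)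
  then show ?thesis
    by (simp only:) (intro has_up_contr has_up_mult has_up_jet assms)
qed

lemma has_up_K_scalar:
  assumes "smooth \<phi>"
  shows "has_up \<alpha> (K_scalar m p q r \<phi>)
    (2 * (p * B_jet \<phi> x \<alpha> + q * m\<^sup>2 * C_jet \<phi> x \<alpha> + r * m ^ 4 * (\<phi> x * up \<alpha> \<phi> x))) x"
proof -
  have K: "K_scalar m p q r \<phi> = (\<lambda>x. p * contr (\<lambda>\<rho>. contr (\<lambda>\<sigma>. (up \<rho> (up \<sigma> \<phi>) x)\<^sup>2))
      + q * m\<^sup>2 * contr (\<lambda>l. (up l \<phi> x)\<^sup>2) + r * m ^ 4 * (\<phi> x)\<^sup>2)"
    using assms by (auto simp: K_scalar_eq contr_def)
  have d: "has_up \<alpha> (K_scalar m p q r \<phi>)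
    (p * contr (\<lambda>\<rho>. contr (\<lambda>\<sigma>. 2 * (up \<rho> (up \<sigma> \<phi>) x * up \<alpha> (up \<rho> (up \<sigma> \<phi>)) x)))
      + q * m\<^sup>2 * contr (\<lambda>l. 2 * (up l \<phi> x * up \<alpha> (up l \<phi>) x)) + r * m ^ 4 * (2 * (\<phi> x * up \<alpha> \<phi> x))) x"
    unfolding K by (intro has_up_add has_up_cmult has_up_contr has_up_square has_up_jet assms)
  show ?thesis
    by (rule has_up_cong_value[OF d])
       (simp add: contr_cmult B_jet_def C_jet_def up_commute[OF assms, of \<alpha>] algebra_simps)
qed

lemma third_up_commute:
  assumes "smooth \<phi>"
  shows "up \<alpha> (up \<beta> (up \<gamma> \<phi>)) x = up \<beta> (up \<alpha> (up \<gamma> \<phi>)) x"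
    "up \<alpha> (up \<beta> (up \<gamma> \<phi>)) x = up \<alpha> (up \<gamma> (up \<beta> \<phi>)) x"
  using assms up_commute[OF smooth_up[OF assms]] up_up_eq[OF assms, of \<beta> \<gamma>]
  by (simp_all add: smooth_up)

lemma klein_gordon_traces:
  assumes "klein_gordon m \<phi>"
  shows "contr (\<lambda>\<alpha>. up \<alpha> (up \<alpha> \<phi>) x) = - m\<^sup>2 * \<phi> x"
    "contr (\<lambda>\<alpha>. up \<alpha> (up \<alpha> (up \<beta> \<phi>)) x) = - m\<^sup>2 * up \<beta> \<phi> x"
proof -
  have s: "smooth \<phi>" using assms by (simp add: klein_gordon_def)
  have tr: "(\<lambda>x. contr (\<lambda>\<alpha>. up \<alpha> (up \<alpha> \<phi>) x)) = (\<lambda>x. - m\<^sup>2 * \<phi> x)"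
    using klein_gordon_up[OF assms] by (auto simp: contr_def)
  then show "contr (\<lambda>\<alpha>. up \<alpha> (up \<alpha> \<phi>) x) = - m\<^sup>2 * \<phi> x" by meson
  \<comment> \<open>The second trace comes from differentiating the field equation: both sides of
    the first trace identity are the same function, so their derivatives coincide.\<close>
  have "has_up \<beta> (\<lambda>x. contr (\<lambda>\<alpha>. up \<alpha> (up \<alpha> \<phi>) x)) (contr (\<lambda>\<alpha>. up \<beta> (up \<alpha> (up \<alpha> \<phi>)) x)) x"
    by (intro has_up_contr has_up_jet s)
  moreover have "has_up \<beta> (\<lambda>x. - m\<^sup>2 * \<phi> x) (- m\<^sup>2 * up \<beta> \<phi> x) x"
    by (intro has_up_cmult has_up_jet s)
  ultimately have "contr (\<lambda>\<alpha>. up \<beta> (up \<alpha> (up \<alpha> \<phi>)) x) = - m\<^sup>2 * up \<beta> \<phi> x"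
    using has_up_unique unfolding tr by blast
  then show "contr (\<lambda>\<alpha>. up \<alpha> (up \<alpha> (up \<beta> \<phi>)) x) = - m\<^sup>2 * up \<beta> \<phi> x"
    by (metis (no_types, lifting) third_up_commute[OF s] contr_def sum.cong)
qed

text \<open>The terms are grouped by powers of \<open>m\<close>, which stay outside the
  coefficients: \<open>e1\<close> to \<open>e4\<close> carry none, \<open>e5\<close> to
  \<open>e8\<close> carry \<open>m^2\<close>, \<open>e9\<close> and \<open>e10\<close> carry
  \<open>m^4\<close>. Pairs related by exchanging \<open>\<gamma>\<close> and
  \<open>\<delta>\<close> share a coefficient, since the ansatz is symmetric in these
  indices.\<close>

definition jet_form ::
  "real \<Rightarrow> real \<Rightarrow> real \<Rightarrow> real \<Rightarrow> real \<Rightarrow> real \<Rightarrow> real \<Rightarrow> real \<Rightarrow> real \<Rightarrow> real \<Rightarrow> real \<Rightarrow>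
    scalar_field \<Rightarrow> spacetime \<Rightarrow> 4 \<Rightarrow> 4 \<Rightarrow> 4 \<Rightarrow> real" where
  "jet_form m e1 e2 e3 e4 e5 e6 e7 e8 e9 e10 \<phi> x \<beta> \<gamma> \<delta> =
    e1 * A_jet \<phi> x \<beta> \<gamma> \<delta>
    + e2 * (A_jet \<phi> x \<gamma> \<beta> \<delta> + A_jet \<phi> x \<delta> \<beta> \<gamma>)
    + e3 * (eta \<gamma> \<delta> * B_jet \<phi> x \<beta>)
    + e4 * (eta \<beta> \<delta> * B_jet \<phi> x \<gamma> + eta \<beta> \<gamma> * B_jet \<phi> x \<delta>)
    + m\<^sup>2 * (e5 * (up \<beta> \<phi> x * up \<gamma> (up \<delta> \<phi>) x)
      + e6 * (up \<gamma> \<phi> x * up \<beta> (up \<delta> \<phi>) x + up \<delta> \<phi> x * up \<beta> (up \<gamma> \<phi>) x)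
      + e7 * (eta \<gamma> \<delta> * C_jet \<phi> x \<beta>)
      + e8 * (eta \<beta> \<delta> * C_jet \<phi> x \<gamma> + eta \<beta> \<gamma> * C_jet \<phi> x \<delta>))
    + m ^ 4 * \<phi> x * (e9 * (eta \<gamma> \<delta> * up \<beta> \<phi> x)
      + e10 * (eta \<beta> \<delta> * up \<gamma> \<phi> x + eta \<beta> \<gamma> * up \<delta> \<phi> x))"

text \<open>The product rule gives the derivative of each term. Contraction then produces traces of
  second and third derivatives, which the field equation lowers to the field and its first
  derivatives at the cost of a factor \<open>- m^2\<close>; what remains is sorted by jet
  expression.\<close>

lemma divergence_general_tensor:
  assumes kg: "klein_gordon m \<phi>"
  shows "(\<Sum>\<alpha>\<in>UNIV. pd \<alpha> (general_tensor m a b c1 c2 d1 d2 p1 q1 r1 p2 q2 r2 \<phi> \<alpha> \<beta> \<gamma> \<delta>) x) =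
    jet_form m (a + c2) ((b + c1 + c2) / 2) (c1 / 2 + p1) (c2 / 2 + p2)
      (d2 - a) ((d1 + d2 - b) / 2) (d1 / 2 - c1 / 2 + q1) (d2 / 2 - c2 / 2 + q2)
      (r1 - d1 / 2) (r2 - d2 / 2) \<phi> x \<beta> \<gamma> \<delta>"
proof -
  have s: "smooth \<phi>" using kg by (simp add: klein_gordon_def)
  define u where "u \<alpha> = up \<alpha> \<phi> x" for \<alpha>
  define h where "h \<alpha> \<beta> = up \<alpha> (up \<beta> \<phi>) x" for \<alpha> \<beta>
  define j where "j \<alpha> \<beta> \<gamma> = up \<alpha> (up \<beta> (up \<gamma> \<phi>)) x" for \<alpha> \<beta> \<gamma>
  \<comment> \<open>\<open>Q\<close> and \<open>L\<close> are the raised derivatives of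
    \<open>dd\<close> and of \<open>K_scalar\<close>.\<close>
  define Q where "Q \<alpha> \<beta> \<gamma> = contr (\<lambda>l. j \<alpha> \<beta> l * h \<gamma> l + h \<beta> l * j \<alpha> \<gamma> l)" for \<alpha> \<beta> \<gamma>
  define L where "L p q r \<alpha> = 2 * (p * B_jet \<phi> x \<alpha> + q * m\<^sup>2 * C_jet \<phi> x \<alpha> + r * m ^ 4 * (\<phi> x * u \<alpha>))"
    for p q r \<alpha>
  have hc: "h \<alpha> \<beta> = h \<beta> \<alpha>" for \<alpha> \<beta> using up_commute[OF s] by (simp add: h_def)
  have jc: "j \<alpha> \<beta> \<gamma> = j \<beta> \<alpha> \<gamma>" "j \<alpha> \<beta> \<gamma> = j \<alpha> \<gamma> \<beta>" for \<alpha> \<beta> \<gamma>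
    using third_up_commute[OF s] by (simp_all add: j_def)
  have trh: "contr (\<lambda>\<alpha>. h \<alpha> \<alpha>) = - m\<^sup>2 * \<phi> x" and trj: "contr (\<lambda>\<alpha>. j \<alpha> \<alpha> \<beta>) = - m\<^sup>2 * u \<beta>" for \<beta>
    using klein_gordon_traces[OF kg] by (simp_all add: h_def j_def u_def)
  have A: "contr (\<lambda>\<alpha>. h \<alpha> \<beta> * j \<alpha> \<gamma> \<delta>) = A_jet \<phi> x \<beta> \<gamma> \<delta>" for \<beta> \<gamma> \<delta>
    by (simp add: A_jet_def h_def j_def)
  have C: "contr (\<lambda>\<alpha>. u \<alpha> * h \<alpha> \<beta>) = C_jet \<phi> x \<beta>" for \<beta>
    by (simp add: C_jet_def h_def u_def)
  have B: "contr (\<lambda>\<alpha>. contr (\<lambda>l. h \<alpha> l * j \<beta> \<alpha> l)) = B_jet \<phi> x \<beta>" for \<beta>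
    by (simp add: B_jet_def h_def j_def)
  have Ac: "A_jet \<phi> x \<beta> \<gamma> \<delta> = A_jet \<phi> x \<beta> \<delta> \<gamma>" for \<beta> \<gamma> \<delta>
    by (rule A_jet_commute[OF s])
  have Q: "Q \<alpha> \<beta> \<gamma> = A_jet \<phi> x \<gamma> \<alpha> \<beta> + A_jet \<phi> x \<beta> \<alpha> \<gamma>" for \<alpha> \<beta> \<gamma>
  proof -
    have "j \<alpha> \<beta> l * h \<gamma> l + h \<beta> l * j \<alpha> \<gamma> l = h l \<gamma> * j l \<alpha> \<beta> + h l \<beta> * j l \<alpha> \<gamma>" for l
      by (simp add: hc[of l] jc(1)[of l \<alpha>] jc(2)[of \<alpha> l])
    then have "Q \<alpha> \<beta> \<gamma> = contr (\<lambda>l. h l \<gamma> * j l \<alpha> \<beta> + h l \<beta> * j l \<alpha> \<gamma>)"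
      by (simp only: Q_def)
    then show ?thesis by (simp only: contr_add A)
  qed
  \<comment> \<open>After exchanging the sums, one half contains the trace of the third derivatives
    and becomes \<open>- m^2\<close> times \<open>C_jet\<close>; the other half is
    \<open>B_jet\<close>.\<close>
  have trQ: "contr (\<lambda>\<alpha>. Q \<alpha> \<alpha> \<beta>) = B_jet \<phi> x \<beta> - m\<^sup>2 * C_jet \<phi> x \<beta>" for \<beta>
  proof -
    have "contr (\<lambda>\<alpha>. Q \<alpha> \<alpha> \<beta>) = contr (\<lambda>l. contr (\<lambda>\<alpha>. j \<alpha> \<alpha> l * h \<beta> l)) + contr (\<lambda>\<alpha>. contr (\<lambda>l. h \<alpha> l * j \<alpha> \<beta> l))"
      unfolding Q_def contr_add by (subst contr_swap) simp
    also have "contr (\<lambda>\<alpha>. contr (\<lambda>l. h \<alpha> l * j \<alpha> \<beta> l)) = B_jet \<phi> x \<beta>"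
      unfolding B[symmetric] by (simp only: jc(1)[of _ \<beta>])
    also have "contr (\<lambda>l. contr (\<lambda>\<alpha>. j \<alpha> \<alpha> l * h \<beta> l)) = - m\<^sup>2 * contr (\<lambda>l. u l * h l \<beta>)"
      unfolding contr_multc trj contr_cmult[symmetric] hc[of \<beta>] by (simp add: mult.assoc)
    finally show ?thesis by (simp add: C)
  qed
  let ?T = "general_tensor m a b c1 c2 d1 d2 p1 q1 r1 p2 q2 r2 \<phi>"
  \<comment> \<open>The product rule written out in the order of the ansatz. Below, the ansatz is
    brought to the matching shape of constants times products, so that the \<open>has_up\<close>
    rules apply structurally.\<close>
  define D where "D \<alpha> =
      a * (j \<alpha> \<alpha> \<beta> * h \<gamma> \<delta> + h \<alpha> \<beta> * j \<alpha> \<gamma> \<delta>)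
    + b / 2 * ((j \<alpha> \<alpha> \<gamma> * h \<beta> \<delta> + h \<alpha> \<gamma> * j \<alpha> \<beta> \<delta>) + (j \<alpha> \<alpha> \<delta> * h \<gamma> \<beta> + h \<alpha> \<delta> * j \<alpha> \<gamma> \<beta>))
    + c1 / 2 * (eta \<alpha> \<beta> * Q \<alpha> \<gamma> \<delta> + eta \<gamma> \<delta> * Q \<alpha> \<alpha> \<beta>)
    + c2 / 2 * (eta \<gamma> \<alpha> * Q \<alpha> \<beta> \<delta> + eta \<gamma> \<beta> * Q \<alpha> \<alpha> \<delta> + (eta \<delta> \<alpha> * Q \<alpha> \<beta> \<gamma> + eta \<delta> \<beta> * Q \<alpha> \<alpha> \<gamma>))
    + d1 * m\<^sup>2 / 2 * (eta \<alpha> \<beta> * (h \<alpha> \<gamma> * u \<delta> + u \<gamma> * h \<alpha> \<delta>) + eta \<gamma> \<delta> * (h \<alpha> \<alpha> * u \<beta> + u \<alpha> * h \<alpha> \<beta>))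
    + d2 * m\<^sup>2 / 2 * (eta \<gamma> \<alpha> * (h \<alpha> \<beta> * u \<delta> + u \<beta> * h \<alpha> \<delta>) + eta \<gamma> \<beta> * (h \<alpha> \<alpha> * u \<delta> + u \<alpha> * h \<alpha> \<delta>)
        + (eta \<delta> \<alpha> * (h \<alpha> \<beta> * u \<gamma> + u \<beta> * h \<alpha> \<gamma>) + eta \<delta> \<beta> * (h \<alpha> \<alpha> * u \<gamma> + u \<alpha> * h \<alpha> \<gamma>)))
    + eta \<gamma> \<delta> / 2 * (eta \<alpha> \<beta> * L p1 q1 r1 \<alpha>)
    + 1 / 2 * (eta \<beta> \<delta> * (eta \<gamma> \<alpha> * L p2 q2 r2 \<alpha>) + eta \<gamma> \<beta> * (eta \<alpha> \<delta> * L p2 q2 r2 \<alpha>))" for \<alpha>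
  have hh: "has_up \<alpha> (\<lambda>x. up \<beta> (up \<gamma> \<phi>) x * up \<delta> (up \<epsilon> \<phi>) x) (j \<alpha> \<beta> \<gamma> * h \<delta> \<epsilon> + h \<beta> \<gamma> * j \<alpha> \<delta> \<epsilon>) x"
    and uu: "has_up \<alpha> (\<lambda>x. up \<beta> \<phi> x * up \<gamma> \<phi> x) (h \<alpha> \<beta> * u \<gamma> + u \<beta> * h \<alpha> \<gamma>) x"
    and QQ: "has_up \<alpha> (dd \<phi> \<beta> \<gamma>) (Q \<alpha> \<beta> \<gamma>) x"
    and LL: "has_up \<alpha> (K_scalar m p q r \<phi>) (L p q r \<alpha>) x" for \<alpha> \<beta> \<gamma> \<delta> \<epsilon> p q r
    unfolding u_def h_def j_def Q_def L_def
    by (intro has_up_mult has_up_jet has_up_dd has_up_K_scalar s)+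
  have D: "has_up \<alpha> (?T \<alpha> \<beta> \<gamma> \<delta>) (D \<alpha>) x" for \<alpha>
  proof -
    have "?T \<alpha> \<beta> \<gamma> \<delta> = (\<lambda>x.
        a * (up \<alpha> (up \<beta> \<phi>) x * up \<gamma> (up \<delta> \<phi>) x)
      + b / 2 * (up \<alpha> (up \<gamma> \<phi>) x * up \<beta> (up \<delta> \<phi>) x + up \<alpha> (up \<delta> \<phi>) x * up \<gamma> (up \<beta> \<phi>) x)
      + c1 / 2 * (eta \<alpha> \<beta> * dd \<phi> \<gamma> \<delta> x + eta \<gamma> \<delta> * dd \<phi> \<alpha> \<beta> x)
      + c2 / 2 * (eta \<gamma> \<alpha> * dd \<phi> \<beta> \<delta> x + eta \<gamma> \<beta> * dd \<phi> \<alpha> \<delta> x + (eta \<delta> \<alpha> * dd \<phi> \<beta> \<gamma> x + eta \<delta> \<beta> * dd \<phi> \<alpha> \<gamma> x))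
      + d1 * m\<^sup>2 / 2 * (eta \<alpha> \<beta> * (up \<gamma> \<phi> x * up \<delta> \<phi> x) + eta \<gamma> \<delta> * (up \<alpha> \<phi> x * up \<beta> \<phi> x))
      + d2 * m\<^sup>2 / 2 * (eta \<gamma> \<alpha> * (up \<beta> \<phi> x * up \<delta> \<phi> x) + eta \<gamma> \<beta> * (up \<alpha> \<phi> x * up \<delta> \<phi> x)
        + (eta \<delta> \<alpha> * (up \<beta> \<phi> x * up \<gamma> \<phi> x) + eta \<delta> \<beta> * (up \<alpha> \<phi> x * up \<gamma> \<phi> x)))
      + eta \<gamma> \<delta> / 2 * (eta \<alpha> \<beta> * K_scalar m p1 q1 r1 \<phi> x)
      + 1 / 2 * (eta \<beta> \<delta> * (eta \<gamma> \<alpha> * K_scalar m p2 q2 r2 \<phi> x) + eta \<gamma> \<beta> * (eta \<alpha> \<delta> * K_scalar m p2 q2 r2 \<phi> x)))"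
      (is "_ = ?F")
      unfolding general_tensor_def symm_def duu_eq[OF s] du_eq up_commute[OF s, of \<gamma> \<alpha>]
      by (rule ext) (simp add: algebra_simps add_divide_distrib)
    moreover have "has_up \<alpha> ?F (D \<alpha>) x"
      unfolding D_def by (intro has_up_add has_up_cmult hh uu QQ LL)
    ultimately show ?thesis by (simp only:)
  qed
  have "(\<Sum>\<alpha>\<in>UNIV. pd \<alpha> (?T \<alpha> \<beta> \<gamma> \<delta>) x) = contr D"
    by (simp add: pd_eq_if_has_up[OF D] contr_def)
  also have "\<dots> = a * (- m\<^sup>2 * u \<beta> * h \<gamma> \<delta> + A_jet \<phi> x \<beta> \<gamma> \<delta>)
    + b / 2 * ((- m\<^sup>2 * u \<gamma> * h \<beta> \<delta> + A_jet \<phi> x \<gamma> \<beta> \<delta>) + (- m\<^sup>2 * u \<delta> * h \<gamma> \<beta> + A_jet \<phi> x \<delta> \<gamma> \<beta>))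
    + c1 / 2 * (Q \<beta> \<gamma> \<delta> + eta \<gamma> \<delta> * (B_jet \<phi> x \<beta> - m\<^sup>2 * C_jet \<phi> x \<beta>))
    + c2 / 2 * (Q \<gamma> \<beta> \<delta> + eta \<gamma> \<beta> * (B_jet \<phi> x \<delta> - m\<^sup>2 * C_jet \<phi> x \<delta>)
        + (Q \<delta> \<beta> \<gamma> + eta \<delta> \<beta> * (B_jet \<phi> x \<gamma> - m\<^sup>2 * C_jet \<phi> x \<gamma>)))
    + d1 * m\<^sup>2 / 2 * (h \<beta> \<gamma> * u \<delta> + u \<gamma> * h \<beta> \<delta> + eta \<gamma> \<delta> * (- m\<^sup>2 * \<phi> x * u \<beta> + C_jet \<phi> x \<beta>))
    + d2 * m\<^sup>2 / 2 * (h \<gamma> \<beta> * u \<delta> + u \<beta> * h \<gamma> \<delta> + eta \<gamma> \<beta> * (- m\<^sup>2 * \<phi> x * u \<delta> + C_jet \<phi> x \<delta>)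
        + (h \<delta> \<beta> * u \<gamma> + u \<beta> * h \<delta> \<gamma> + eta \<delta> \<beta> * (- m\<^sup>2 * \<phi> x * u \<gamma> + C_jet \<phi> x \<gamma>)))
    + eta \<gamma> \<delta> / 2 * L p1 q1 r1 \<beta>
    + 1 / 2 * (eta \<beta> \<delta> * L p2 q2 r2 \<gamma> + eta \<gamma> \<beta> * L p2 q2 r2 \<delta>)"
    unfolding D_def by (simp only: contr_add contr_cmult contr_eta contr_multc trj trh trQ A C)
  also have "\<dots> = (a + c2) * A_jet \<phi> x \<beta> \<gamma> \<delta>
    + (b + c1 + c2) / 2 * (A_jet \<phi> x \<gamma> \<beta> \<delta> + A_jet \<phi> x \<delta> \<beta> \<gamma>)
    + (c1 / 2 + p1) * (eta \<gamma> \<delta> * B_jet \<phi> x \<beta>)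
    + (c2 / 2 + p2) * (eta \<beta> \<delta> * B_jet \<phi> x \<gamma> + eta \<beta> \<gamma> * B_jet \<phi> x \<delta>)
    + m\<^sup>2 * ((d2 - a) * (u \<beta> * h \<gamma> \<delta>)
      + (d1 + d2 - b) / 2 * (u \<gamma> * h \<beta> \<delta> + u \<delta> * h \<beta> \<gamma>)
      + (d1 / 2 - c1 / 2 + q1) * (eta \<gamma> \<delta> * C_jet \<phi> x \<beta>)
      + (d2 / 2 - c2 / 2 + q2) * (eta \<beta> \<delta> * C_jet \<phi> x \<gamma> + eta \<beta> \<gamma> * C_jet \<phi> x \<delta>))
    + m ^ 4 * \<phi> x * ((r1 - d1 / 2) * (eta \<gamma> \<delta> * u \<beta>)
      + (r2 - d2 / 2) * (eta \<beta> \<delta> * u \<gamma> + eta \<beta> \<gamma> * u \<delta>))"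
  proof -
    have m4: "m ^ 4 = m\<^sup>2 * m\<^sup>2" by (simp add: power2_eq_square power4_eq_xxxx)
    show ?thesis
      unfolding Q L_def m4 hc[of \<gamma> \<beta>] hc[of \<delta> \<beta>] hc[of \<delta> \<gamma>] eta_commute[of \<gamma> \<beta>] eta_commute[of \<delta> \<beta>]
        Ac[of \<delta> \<gamma> \<beta>] Ac[of \<gamma> \<delta> \<beta>] Ac[of \<beta> \<delta> \<gamma>]
      by (simp add: algebra_simps add_divide_distrib diff_divide_distrib)
  qed
  finally show ?thesis unfolding u_def h_def jet_form_def .
qed

section \<open>Exponential solutions\<close>

text \<open>This family is closed under differentiation, which only changes the two amplitudes, so
  jets at the origin are polynomials in \<open>k\<close> and \<open>l\<close>. The exponent is the
  Euclidean product, so \<open>k\<close> and \<open>l\<close> are covectors with lower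
  indices.\<close>

definition two_exp :: "spacetime \<Rightarrow> spacetime \<Rightarrow> real \<Rightarrow> real \<Rightarrow> scalar_field" where
  "two_exp k l a b x = a * exp (k \<bullet> x) + b * exp (l \<bullet> x)"

lemma pd_two_exp: "pd \<alpha> (two_exp k l a b) = two_exp k l (a * k $ \<alpha>) (b * l $ \<alpha>)"
proof (rule ext, rule pd_eqI)
  fix x
  show "((\<lambda>t. two_exp k l a b (x + t *\<^sub>R axis \<alpha> 1)) has_real_derivative
      two_exp k l (a * k $ \<alpha>) (b * l $ \<alpha>) x) (at 0)"
    unfolding two_exp_def
    by (auto intro!: derivative_eq_intros simp: inner_add_right inner_axis)
qed

lemma smooth_two_exp: "smooth (two_exp k l a b)"
proof -
  have "\<exists>a' b'. foldr pd is (two_exp k l a b) = two_exp k l a' b'" for "is"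
    by (induction "is") (auto, metis pd_two_exp)
  moreover have "two_exp k l a' b' differentiable (at x)" for a' b' x
    unfolding two_exp_def[abs_def] differentiable_def by (rule exI) (auto intro!: derivative_eq_intros)
  ultimately show ?thesis unfolding smooth_def by metis
qed

lemma up_two_exp:
  "up \<alpha> (two_exp k l a b) = two_exp k l (a * (eta \<alpha> \<alpha> * k $ \<alpha>)) (b * (eta \<alpha> \<alpha> * l $ \<alpha>))"
  by (auto simp: up_def pd_two_exp two_exp_def algebra_simps)

lemma two_exp_0: "two_exp k l a b 0 = a + b"
  by (simp add: two_exp_def)

lemma contr_lower: "contr (\<lambda>\<alpha>. (eta \<alpha> \<alpha> * X \<alpha>) * (eta \<alpha> \<alpha> * Y \<alpha>)) = contr (\<lambda>\<alpha>. X \<alpha> * Y \<alpha>)"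
proof -
  have "(eta \<alpha> \<alpha> * X \<alpha>) * (eta \<alpha> \<alpha> * Y \<alpha>) = X \<alpha> * Y \<alpha>" for \<alpha>
    by (simp add: eta_def)
  then show ?thesis by (simp only:)
qed

text \<open>With real exponents the d'Alembertian multiplies each exponential by the Minkowski
  square of its covector, hence the value \<open>- m^2\<close>, opposite in sign to that of an
  oscillating plane wave.\<close>

lemma klein_gordon_two_exp:
  assumes "contr (\<lambda>\<alpha>. k $ \<alpha> * k $ \<alpha>) = - m\<^sup>2" "contr (\<lambda>\<alpha>. l $ \<alpha> * l $ \<alpha>) = - m\<^sup>2"
  shows "klein_gordon m (two_exp k l a b)"
proof -
  have "dalembert (two_exp k l a b) x = contr (\<lambda>\<alpha>. (k $ \<alpha> * k $ \<alpha>) * (a * exp (k \<bullet> x)) + (l $ \<alpha> * l $ \<alpha>) * (b * exp (l \<bullet> x)))" for x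
    by (simp add: dalembert_def dll_def pd_two_exp two_exp_def sum_eta_left contr_def mult_ac)
  then show ?thesis
    unfolding klein_gordon_def
    by (simp add: smooth_two_exp contr_add contr_multc assms) (simp add: two_exp_def algebra_simps)
qed

text \<open>Polarization: subtracting the values at \<open>exp (k \<bullet> x) - exp (l \<bullet> x)\<close> from those at
  \<open>exp (k \<bullet> x) + exp (l \<bullet> x)\<close> leaves only the cross terms.\<close>

lemma jet_form_two_exp_cross:
  fixes k l :: spacetime
  assumes kk: "contr (\<lambda>\<alpha>. k $ \<alpha> * k $ \<alpha>) = - m\<^sup>2" and ll: "contr (\<lambda>\<alpha>. l $ \<alpha> * l $ \<alpha>) = - m\<^sup>2"
    and kl: "contr (\<lambda>\<alpha>. k $ \<alpha> * l $ \<alpha>) = s"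
    and zero: "\<And>\<phi>. klein_gordon m \<phi> \<Longrightarrow> jet_form m e1 e2 e3 e4 e5 e6 e7 e8 e9 e10 \<phi> 0 \<beta> \<gamma> \<delta> = 0"
  defines "K \<equiv> \<lambda>\<alpha>. eta \<alpha> \<alpha> * k $ \<alpha>" and "L \<equiv> \<lambda>\<alpha>. eta \<alpha> \<alpha> * l $ \<alpha>"
  shows "(s * e1 + m\<^sup>2 * e5) * (K \<beta> * L \<gamma> * L \<delta> + L \<beta> * K \<gamma> * K \<delta>)
    + (s * e2 + m\<^sup>2 * e6) * (K \<gamma> * L \<beta> * L \<delta> + L \<gamma> * K \<beta> * K \<delta> + K \<delta> * L \<beta> * L \<gamma> + L \<delta> * K \<beta> * K \<gamma>)
    + (s\<^sup>2 * e3 + s * m\<^sup>2 * e7 + m ^ 4 * e9) * (eta \<gamma> \<delta> * (K \<beta> + L \<beta>))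
    + (s\<^sup>2 * e4 + s * m\<^sup>2 * e8 + m ^ 4 * e10) * (eta \<beta> \<delta> * (K \<gamma> + L \<gamma>) + eta \<beta> \<gamma> * (K \<delta> + L \<delta>)) = 0"
    (is "?X = 0")
proof -
  let ?f = "two_exp k l 1"
  have KK: "contr (\<lambda>\<alpha>. K \<alpha> * K \<alpha>) = - m\<^sup>2" and LL: "contr (\<lambda>\<alpha>. L \<alpha> * L \<alpha>) = - m\<^sup>2"
    and KL: "contr (\<lambda>\<alpha>. K \<alpha> * L \<alpha>) = s"
    unfolding K_def L_def contr_lower by (fact kk ll kl)+
  have up: "up \<alpha> (two_exp k l a b) = two_exp k l (a * K \<alpha>) (b * L \<alpha>)" for \<alpha> a b
    by (simp add: up_two_exp K_def L_def)
  \<comment> \<open>At the origin every jet expression is a polynomial of degree two in the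
    amplitude \<open>b\<close>: the constant part belongs to \<open>k\<close> alone, the quadratic
    part to \<open>l\<close> alone, the linear part is the cross term.\<close>
  have A: "A_jet (?f b) 0 \<beta> \<gamma> \<delta> = - m\<^sup>2 * K \<beta> * K \<gamma> * K \<delta>
      + b * (s * (K \<beta> * L \<gamma> * L \<delta> + L \<beta> * K \<gamma> * K \<delta>)) - b\<^sup>2 * (m\<^sup>2 * L \<beta> * L \<gamma> * L \<delta>)" for b \<beta> \<gamma> \<delta>
  proof -
    have "A_jet (?f b) 0 \<beta> \<gamma> \<delta> = contr (\<lambda>\<alpha>.
        (K \<alpha> * K \<alpha>) * (K \<beta> * K \<gamma> * K \<delta>) + (K \<alpha> * L \<alpha>) * (b * (K \<beta> * L \<gamma> * L \<delta> + L \<beta> * K \<gamma> * K \<delta>))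
        + (L \<alpha> * L \<alpha>) * (b\<^sup>2 * L \<beta> * L \<gamma> * L \<delta>))"
      unfolding A_jet_def up two_exp_0 by (simp add: algebra_simps power2_eq_square)
    then show ?thesis
      by (simp add: contr_add contr_multc KK LL KL)
  qed
  have C: "C_jet (?f b) 0 \<beta> = - m\<^sup>2 * K \<beta> + b * (s * (K \<beta> + L \<beta>)) - b\<^sup>2 * (m\<^sup>2 * L \<beta>)" for b \<beta>
  proof -
    have "C_jet (?f b) 0 \<beta> = contr (\<lambda>\<alpha>. (K \<alpha> * K \<alpha>) * K \<beta> + (K \<alpha> * L \<alpha>) * (b * (K \<beta> + L \<beta>))
        + (L \<alpha> * L \<alpha>) * (b\<^sup>2 * L \<beta>))"
      unfolding C_jet_def up two_exp_0 by (simp add: algebra_simps power2_eq_square)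
    then show ?thesis
      by (simp add: contr_add contr_multc KK LL KL)
  qed
  have B: "B_jet (?f b) 0 \<beta> = m ^ 4 * K \<beta> + b * (s\<^sup>2 * (K \<beta> + L \<beta>)) + b\<^sup>2 * (m ^ 4 * L \<beta>)" for b \<beta>
  proof -
    have "B_jet (?f b) 0 \<beta> = contr (\<lambda>\<alpha>. contr (\<lambda>\<gamma>. (K \<gamma> * K \<gamma>) * (K \<alpha> * K \<alpha> * K \<beta>)
        + (K \<gamma> * L \<gamma>) * (K \<alpha> * L \<alpha> * (b * (K \<beta> + L \<beta>))) + (L \<gamma> * L \<gamma>) * (L \<alpha> * L \<alpha> * (b\<^sup>2 * L \<beta>))))"
      unfolding B_jet_def up two_exp_0 by (simp add: algebra_simps power2_eq_square)
    also have "\<dots> = - m\<^sup>2 * (- m\<^sup>2 * K \<beta>) + s * (s * (b * (K \<beta> + L \<beta>))) + - m\<^sup>2 * (- m\<^sup>2 * (b\<^sup>2 * L \<beta>))"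
      by (simp only: contr_add contr_multc contr_cmult KK LL KL)
    finally show ?thesis
      by (simp add: algebra_simps power2_eq_square power4_eq_xxxx)
  qed
  let ?J = "jet_form m e1 e2 e3 e4 e5 e6 e7 e8 e9 e10"
  \<comment> \<open>The parts even in \<open>b\<close> agree at 1 and -1, so twice the linear part
    remains.\<close>
  have "?J (?f 1) 0 \<beta> \<gamma> \<delta> - ?J (?f (- 1)) 0 \<beta> \<gamma> \<delta> = 2 * ?X"
    unfolding jet_form_def A B C up two_exp_0 by (simp add: algebra_simps)
  moreover have "?J (?f 1) 0 \<beta> \<gamma> \<delta> = 0" "?J (?f (- 1)) 0 \<beta> \<gamma> \<delta> = 0"
    by (intro zero klein_gordon_two_exp kk ll)+
  ultimately show ?thesis by simp
qed

text \<open>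
  With \<open>k = (1, 0, w, 0)\<close> and \<open>l = (t, v, 0, 0)\<close> the components \<open>133\<close>, \<open>331\<close>, \<open>011\<close>, \<open>100\<close> of the
  identity above isolate its four coefficients one after the other.
\<close>

lemma jet_form_coefficients:
  assumes zero: "\<And>\<phi> \<beta> \<gamma> \<delta>. klein_gordon m \<phi> \<Longrightarrow> jet_form m e1 e2 e3 e4 e5 e6 e7 e8 e9 e10 \<phi> 0 \<beta> \<gamma> \<delta> = 0"
    and t: "t \<noteq> 0"
  shows "t * e1 + m\<^sup>2 * e5 = 0" "t * e2 + m\<^sup>2 * e6 = 0"
    "t\<^sup>2 * e3 + t * m\<^sup>2 * e7 + m ^ 4 * e9 = 0" "t\<^sup>2 * e4 + t * m\<^sup>2 * e8 + m ^ 4 * e10 = 0"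
proof -
  \<comment> \<open>\<open>w\<close> and \<open>v\<close> solve \<open>1 - w^2 = - m^2\<close> and
    \<open>t^2 - v^2 = - m^2\<close>. The spatial parts of \<open>k\<close> and \<open>l\<close> are
    orthogonal, so their Minkowski product is \<open>t\<close>.\<close>
  define w where "w = sqrt (1 + m\<^sup>2)"
  define v where "v = sqrt (t\<^sup>2 + m\<^sup>2)"
  have w: "w * w = 1 + m\<^sup>2" and v: "v * v = t\<^sup>2 + m\<^sup>2" by (simp_all add: w_def v_def)
  have v0: "v \<noteq> 0" using t by (simp add: v_def sum_power2_eq_zero_iff)
  define k :: spacetime where "k = (\<chi> i. if i = 0 then 1 else if i = 2 then w else 0)"
  define l :: spacetime where "l = (\<chi> i. if i = 0 then t else if i = 1 then v else 0)"
  \<comment> \<open>\<open>sum_4\<close> runs over 1, 2, 3, 4, and the last of these is the time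
    index.\<close>
  have four: "(4 :: 4) = 0" by simp
  have k: "k $ 0 = 1" "k $ 1 = 0" "k $ 2 = w" "k $ 3 = 0" by (simp_all add: k_def)
  have l: "l $ 0 = t" "l $ 1 = v" "l $ 2 = 0" "l $ 3 = 0" by (simp_all add: l_def)
  have e: "eta 0 0 = 1" "eta 1 1 = -1" "eta 2 2 = -1" "eta 3 3 = -1"
    "eta 0 1 = 0" "eta 1 0 = 0" "eta 1 3 = 0" "eta 3 1 = 0" by (simp_all add: eta_def)
  have c: "contr (\<lambda>\<alpha>. k $ \<alpha> * k $ \<alpha>) = - m\<^sup>2" "contr (\<lambda>\<alpha>. l $ \<alpha> * l $ \<alpha>) = - m\<^sup>2"
    "contr (\<lambda>\<alpha>. k $ \<alpha> * l $ \<alpha>) = t"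
    unfolding contr_def sum_4 four by (simp_all add: k l e w v power2_eq_square)
  note X = jet_form_two_exp_cross[OF c zero]
  \<comment> \<open>Index 3 kills \<open>K\<close> and \<open>L\<close>, so only a term with
    \<open>eta 3 3\<close> survives in this component and the next; its factor
    \<open>K 1 + L 1 = - v\<close> is nonzero.\<close>
  show e379: "t\<^sup>2 * e3 + t * m\<^sup>2 * e7 + m ^ 4 * e9 = 0"
    using X[of 1 3 3] v0 by (simp add: k l e)
  show "t\<^sup>2 * e4 + t * m\<^sup>2 * e8 + m ^ 4 * e10 = 0"
    using X[of 3 3 1] v0 by (simp add: k l e)
  \<comment> \<open>Since \<open>K 1 = 0\<close>, the first bracket is \<open>v^2\<close> and the
    second vanishes.\<close>
  show e15: "t * e1 + m\<^sup>2 * e5 = 0"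
    using X[of 0 1 1] v0 by (simp add: k l e e379)
  \<comment> \<open>The second bracket is \<open>- 2 * v * t\<close>, nonzero because
    \<open>t\<close> and \<open>v\<close> are.\<close>
  show "t * e2 + m\<^sup>2 * e6 = 0"
    using X[of 1 0 0] v0 t by (simp add: k l e e379 e15)
qed

text \<open>The relations hold for every nonzero \<open>t\<close>, so they are polynomial
  identities: the values 1 and -1 settle the linear ones, and 1, -1 and 2 the quadratic ones. Powers
  of \<open>m\<close> remain attached to \<open>e5\<close> to \<open>e10\<close> and can be
  cancelled when \<open>m\<close> is nonzero.\<close>

lemma jet_form_coefficients_zero:
  assumes zero: "\<And>\<phi> \<beta> \<gamma> \<delta>. klein_gordon m \<phi> \<Longrightarrow> jet_form m e1 e2 e3 e4 e5 e6 e7 e8 e9 e10 \<phi> 0 \<beta> \<gamma> \<delta> = 0"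
  shows "e1 = 0" "e2 = 0" "e3 = 0" "e4 = 0"
    "m \<noteq> 0 \<Longrightarrow> e5 = 0" "m \<noteq> 0 \<Longrightarrow> e6 = 0" "m \<noteq> 0 \<Longrightarrow> e7 = 0" "m \<noteq> 0 \<Longrightarrow> e8 = 0"
    "m \<noteq> 0 \<Longrightarrow> e9 = 0" "m \<noteq> 0 \<Longrightarrow> e10 = 0"
proof -
  have lin: "x = 0 \<and> y = 0" if "\<And>t :: real. t \<noteq> 0 \<Longrightarrow> t * x + y = 0" for x y
    using that[of 1] that[of "- 1"] by simp
  have quad: "x = 0 \<and> y = 0 \<and> z = 0" if "\<And>t :: real. t \<noteq> 0 \<Longrightarrow> t\<^sup>2 * x + t * y + z = 0" for x y z
    using that[of 1] that[of "- 1"] that[of 2] by simp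
  note coeff = jet_form_coefficients[OF zero]
  have "e1 = 0 \<and> m\<^sup>2 * e5 = 0" "e2 = 0 \<and> m\<^sup>2 * e6 = 0"
    by (rule lin, use coeff in blast)+
  moreover have "e3 = 0 \<and> m\<^sup>2 * e7 = 0 \<and> m ^ 4 * e9 = 0" "e4 = 0 \<and> m\<^sup>2 * e8 = 0 \<and> m ^ 4 * e10 = 0"
    by (rule quad, use coeff in \<open>simp add: mult.assoc\<close>)+
  ultimately show "e1 = 0" "e2 = 0" "e3 = 0" "e4 = 0"
    "m \<noteq> 0 \<Longrightarrow> e5 = 0" "m \<noteq> 0 \<Longrightarrow> e6 = 0" "m \<noteq> 0 \<Longrightarrow> e7 = 0" "m \<noteq> 0 \<Longrightarrow> e8 = 0"
    "m \<noteq> 0 \<Longrightarrow> e9 = 0" "m \<noteq> 0 \<Longrightarrow> e10 = 0"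
    by auto
qed

section \<open>The two-parameter family inside the ansatz, and the classification\<close>

lemma dd_commute: "smooth \<phi> \<Longrightarrow> dd \<phi> \<alpha> \<beta> x = dd \<phi> \<beta> \<alpha> x"
  by (simp add: dd_eq mult.commute)

text \<open>The constants come from expanding \<open>tau\<close>: each coefficient of
  \<open>dd\<close> (\<open>a - b\<close> and \<open>- a\<close>) recurs with opposite sign at
  \<open>m^2 du du\<close>, and again with opposite sign at \<open>K\<close>.\<close>

lemma T1_T2_eq_general_tensor:
  assumes s: "smooth \<phi>"
  shows "a * T1 m \<phi> \<alpha> \<beta> \<gamma> \<delta> x + b * T2 m \<phi> \<alpha> \<beta> \<gamma> \<delta> x =
    general_tensor m a b (a - b) (- a) (b - a) a ((b - a) / 2) (a - b) ((b - a) / 2)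
      (a / 2) (- a) (a / 2) \<phi> \<alpha> \<beta> \<gamma> \<delta> x"
proof -
  have h: "duu \<phi> \<mu> \<nu> x = duu \<phi> \<nu> \<mu> x" for \<mu> \<nu>
    using s by (simp add: duu_eq up_commute)
  define K where "K = K_scalar m (1 / 2) (- 1) (1 / 2) \<phi> x"
  have K1: "K_scalar m ((b - a) / 2) (a - b) ((b - a) / 2) \<phi> x = (b - a) * K"
    and K2: "K_scalar m (a / 2) (- a) (a / 2) \<phi> x = a * K"
    by (simp_all add: K_def K_scalar_def algebra_simps diff_divide_distrib)
  have tau: "tau m \<phi> \<mu> \<nu> x = dd \<phi> \<mu> \<nu> x - m\<^sup>2 * (du \<phi> \<mu> x * du \<phi> \<nu> x) - K * eta \<mu> \<nu> / 2" for \<mu> \<nu>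
    by (simp add: tau_def K_def)
  show ?thesis
    unfolding T1_def T2_def general_tensor_def symm_def K1 K2 tau
      h[of \<gamma> \<alpha>] h[of \<delta> \<beta>] h[of \<delta> \<alpha>] h[of \<gamma> \<beta>]
      dd_commute[OF s, of \<gamma> \<beta>] dd_commute[OF s, of \<gamma> \<alpha>] dd_commute[OF s, of \<delta> \<beta>] dd_commute[OF s, of \<delta> \<alpha>]
      eta_commute[of \<gamma> \<beta>] eta_commute[of \<gamma> \<alpha>] eta_commute[of \<delta> \<beta>] eta_commute[of \<delta> \<alpha>]
    by (simp add: algebra_simps add_divide_distrib diff_divide_distrib)
qed

theorem theorem1:
  fixes m :: real and T :: "scalar_field \<Rightarrow> tensor4"
  assumes "m \<ge> 0"
  shows "P1_P2 m T \<and> P3 m T \<longleftrightarrow>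
    (\<exists>a b. \<forall>\<phi>. smooth \<phi> \<longrightarrow>
      (\<forall>\<alpha> \<beta> \<gamma> \<delta> x. T \<phi> \<alpha> \<beta> \<gamma> \<delta> x = a * T1 m \<phi> \<alpha> \<beta> \<gamma> \<delta> x + b * T2 m \<phi> \<alpha> \<beta> \<gamma> \<delta> x))"
proof
  assume "P1_P2 m T \<and> P3 m T"
  then obtain a b c1 c2 d1 d2 p1 q1 r1 p2 q2 r2
    where T: "\<And>\<phi>. smooth \<phi> \<Longrightarrow> T \<phi> = general_tensor m a b c1 c2 d1 d2 p1 q1 r1 p2 q2 r2 \<phi>"
      and P3: "P3 m T"
    unfolding P1_P2_def by metis
  have "jet_form m (a + c2) ((b + c1 + c2) / 2) (c1 / 2 + p1) (c2 / 2 + p2)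
      (d2 - a) ((d1 + d2 - b) / 2) (d1 / 2 - c1 / 2 + q1) (d2 / 2 - c2 / 2 + q2)
      (r1 - d1 / 2) (r2 - d2 / 2) \<phi> 0 \<beta> \<gamma> \<delta> = 0" if kg: "klein_gordon m \<phi>" for \<phi> \<beta> \<gamma> \<delta>
  proof -
    have "smooth \<phi>" using kg by (simp add: klein_gordon_def)
    then show ?thesis
      unfolding divergence_general_tensor[OF kg, symmetric] T[symmetric, OF \<open>smooth \<phi>\<close>]
      using P3 kg by (simp add: P3_def)
  qed
  note e = jet_form_coefficients_zero[OF this]
  \<comment> \<open>The four coefficients without a power of \<open>m\<close> fix these constants
    for every mass.\<close>
  have massless: "c2 = - a" "c1 = a - b" "p1 = (b - a) / 2" "p2 = a / 2"
    using e(1-4) by simp_all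
  have massive: "d2 = a" "d1 = b - a" if "m \<noteq> 0"
    using e(5,6) that massless by simp_all
  have massive': "q1 = a - b" "q2 = - a" "r1 = (b - a) / 2" "r2 = a / 2" if "m \<noteq> 0"
  proof -
    have "q1 = c1 / 2 - d1 / 2" "q2 = c2 / 2 - d2 / 2" "r1 = d1 / 2" "r2 = d2 / 2"
      using e(7-10) that by simp_all
    then show "q1 = a - b" "q2 = - a" "r1 = (b - a) / 2" "r2 = a / 2"
      by (simp_all add: massless massive[OF that] field_simps)
  qed
  \<comment> \<open>For \<open>m = 0\<close> the constants \<open>d\<close>, \<open>q\<close>,
    \<open>r\<close> are not determined, but they are multiplied by powers of \<open>m\<close>, so
    the two tensors still agree as expressions.\<close>
  have "general_tensor m a b c1 c2 d1 d2 p1 q1 r1 p2 q2 r2 =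
    general_tensor m a b (a - b) (- a) (b - a) a ((b - a) / 2) (a - b) ((b - a) / 2) (a / 2) (- a) (a / 2)"
  proof (cases "m = 0")
    case True
    then show ?thesis by (intro ext) (simp add: general_tensor_def K_scalar_def massless)
  next
    case False
    then show ?thesis by (simp only: massless massive[OF False] massive'[OF False])
  qed
  then show "\<exists>a b. \<forall>\<phi>. smooth \<phi> \<longrightarrow>
      (\<forall>\<alpha> \<beta> \<gamma> \<delta> x. T \<phi> \<alpha> \<beta> \<gamma> \<delta> x = a * T1 m \<phi> \<alpha> \<beta> \<gamma> \<delta> x + b * T2 m \<phi> \<alpha> \<beta> \<gamma> \<delta> x)"
    by (intro exI[of _ a] exI[of _ b]) (simp add: T T1_T2_eq_general_tensor)
next
  assume "\<exists>a b. \<forall>\<phi>. smooth \<phi> \<longrightarrow>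
      (\<forall>\<alpha> \<beta> \<gamma> \<delta> x. T \<phi> \<alpha> \<beta> \<gamma> \<delta> x = a * T1 m \<phi> \<alpha> \<beta> \<gamma> \<delta> x + b * T2 m \<phi> \<alpha> \<beta> \<gamma> \<delta> x)"
  then obtain a b where "\<And>\<phi> \<alpha> \<beta> \<gamma> \<delta> x. smooth \<phi> \<Longrightarrow>
      T \<phi> \<alpha> \<beta> \<gamma> \<delta> x = a * T1 m \<phi> \<alpha> \<beta> \<gamma> \<delta> x + b * T2 m \<phi> \<alpha> \<beta> \<gamma> \<delta> x"
    by blast
  then have T: "T \<phi> = general_tensor m a b (a - b) (- a) (b - a) a ((b - a) / 2) (a - b) ((b - a) / 2)
      (a / 2) (- a) (a / 2) \<phi>" if "smooth \<phi>" for \<phi>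
    using that by (intro ext) (simp add: T1_T2_eq_general_tensor)
  have "P3 m T"
    unfolding P3_def
  proof (intro allI impI)
    fix \<phi> \<beta> \<gamma> \<delta> x assume kg: "klein_gordon m \<phi>"
    then have "smooth \<phi>" by (simp add: klein_gordon_def)
    \<comment> \<open>With these constants all ten coefficients of the divergence cancel identically
      in \<open>a\<close> and \<open>b\<close>.\<close>
    then show "(\<Sum>\<alpha>\<in>UNIV. pd \<alpha> (T \<phi> \<alpha> \<beta> \<gamma> \<delta>) x) = 0"
      by (simp add: T divergence_general_tensor[OF kg]) (simp add: jet_form_def diff_divide_distrib)
  qed
  moreover have "P1_P2 m T"
    unfolding P1_P2_def using T by blast
  ultimately show "P1_P2 m T \<and> P3 m T" by simp
qed

end
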